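(* Let $p\in\{1,2,\dots\}\cup\{\infty\}$, let $f:D\cup\{e^{it}:0<t<1\}\to\mathbb{C}$ be continuous and holomorphic in $D$, and define $g:(0,1)\to\mathbb{C}$ by $g(t)=f(e^{it})$. Then $f^{(l)}$ extends continuously to $D\cup\{e^{it}:0<t<1\}$ for all $l\in\{0,1,2,\dots\}$ with $l\le p$ if and only if $g\in C^p((0,1))$. In that case, for all $t\in(0,1)$, $$\frac{dg}{dt}(t)=ie^{it}f'(e^{it}),$$ where $f'(e^{it})$ denotes the value at $e^{it}$ of the continuous extension of $f'$.
   Context: $D$ is the open unit disk in $\mathbb{C}$. $f^{(l)}$ denotes the $l$-th complex derivative of $f$ in $D$. $C^p((0,1))$ is the set of complex-valued functions of class $C^p$ on the real interval $(0,1)$. *)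

theory Defs
  imports "HOL-Analysis.Analysis" "HOL-Library.Extended_Nat"
begin

definition open_arc :: "complex set" where
  "open_arc = {exp (\<i> * of_real t) | t :: real. 0 < t \<and> t < 1}"

text \<open>\<open>F\<close> is a continuous extension to \<open>S\<close> of the function \<open>h\<close> given on \<open>A \<subseteq> S\<close>;
  the values of \<open>F\<close> outside \<open>S\<close> and of \<open>h\<close> outside \<open>A\<close> are irrelevant.\<close>

definition continuous_extension ::
    "('a::topological_space \<Rightarrow> 'b::topological_space) \<Rightarrow> 'a set \<Rightarrow> 'a set \<Rightarrow> ('a \<Rightarrow> 'b) \<Rightarrow> bool" where
  "continuous_extension h A S F \<longleftrightarrow> continuous_on S F \<and> (\<forall>x\<in>A. F x = h x)"

definition iterated_vector_derivative ::
    "nat \<Rightarrow> (real \<Rightarrow> 'a::real_normed_vector) \<Rightarrow> real \<Rightarrow> 'a" where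
  "iterated_vector_derivative l g = ((\<lambda>h t. vector_derivative h (at t)) ^^ l) g"

text \<open>Class \<open>C\<^sup>p\<close> on a set \<open>S\<close>, intended for open \<open>S\<close> (the derivatives are two-sided), with
  \<open>p = \<infinity>\<close> allowed. Differentiability is demanded explicitly, because \<^const>\<open>vector_derivative\<close>
  has an arbitrary value where the derivative does not exist.\<close>

definition Cp_on :: "enat \<Rightarrow> real set \<Rightarrow> (real \<Rightarrow> 'a::real_normed_vector) \<Rightarrow> bool" where
  "Cp_on p S g \<longleftrightarrow>
     (\<forall>l. enat l < p \<longrightarrow> (\<forall>t\<in>S. iterated_vector_derivative l g differentiable (at t))) \<and>
     (\<forall>l. enat l \<le> p \<longrightarrow> continuous_on S (iterated_vector_derivative l g))"

end

theory Submission
  imports Defs "HOL-Complex_Analysis.Complex_Analysis"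
begin

text \<open>
  If \<open>f'\<close> extends continuously, the mean value inequality inside the disk passes to the boundary and
  shows that \<open>f\<close> is complex differentiable there relative to the disk with its arc, so the chain rule
  gives \<open>g'\<close>.

  Conversely, let \<open>g\<close> be \<open>C\<^sup>1\<close> and put \<open>\<phi>(w) = f(e\<^sup>i\<^sup>w)\<close>, holomorphic in the upper half plane with
  boundary values \<open>g\<close>. On a rectangle with lower corners \<open>a\<close>, \<open>b\<close> consider the weighted difference
  quotients \<open>(w - a)\<^sup>2 (w - b)\<^sup>2 (\<phi>(w + h) - \<phi>(w)) / h\<close> for real \<open>h \<rightarrow> 0\<close>. They converge uniformly on the
  boundary of the rectangle: on the lower side because \<open>g'\<close> is continuous, on the other sides because
  of the Cauchy estimate \<open>\<bar>\<phi>''(w)\<bar> \<le> 2 B / (Im w)\<^sup>2\<close>, whose blow-up at the corners the weight absorbs.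
  By the maximum principle they converge uniformly on the whole rectangle, so \<open>\<phi>'\<close> extends
  continuously to the open lower side.

  Higher orders follow by induction, replacing \<open>(f, g)\<close> by \<open>(i z f', g')\<close>.
\<close>

section \<open>Differentiability up to the boundary, and uniform convergence from the
  frontier\<close>

text \<open>Subtracting the linear part \<open>F \<zeta> * z\<close> leaves a function with
  derivative \<open>F z - F \<zeta>\<close>, which is at most \<open>e\<close> in modulus on the
  convex set \<open>S \<inter> ball \<zeta> d\<close>. So it is \<open>e\<close>-Lipschitz there,
  and this estimate survives limits of sequences from \<open>S\<close> to \<open>y\<close> and to
  \<open>\<zeta>\<close>.\<close>

lemma has_field_derivative_boundary:
  fixes f F :: "complex \<Rightarrow> complex"
  assumes S: "convex S" and ST: "S \<subseteq> T" "T \<subseteq> closure S"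
    and f: "continuous_on T f" and F: "continuous_on T F"
    and der: "\<And>z. z \<in> S \<Longrightarrow> (f has_field_derivative F z) (at z within S)"
    and \<zeta>: "\<zeta> \<in> T"
  shows "(f has_field_derivative F \<zeta>) (at \<zeta> within T)"
  unfolding has_field_derivative_def has_derivative_within_alt2
proof (intro conjI allI impI)
  show "bounded_linear ((*) (F \<zeta>))"
    by (rule bounded_linear_mult_right)
  fix e :: real
  assume e: "e > 0"
  obtain d where d: "d > 0" "\<forall>z\<in>T. dist z \<zeta> < d \<longrightarrow> dist (F z) (F \<zeta>) < e"
    using F \<zeta> e unfolding continuous_on_iff by blast
  have inside: "cmod ((f z - F \<zeta> * z) - (f w - F \<zeta> * w)) \<le> e * cmod (z - w)"
    if "z \<in> S \<inter> ball \<zeta> d" "w \<in> S \<inter> ball \<zeta> d" for z w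
  proof (rule field_differentiable_bound[of "S \<inter> ball \<zeta> d" _ "\<lambda>z. F z - F \<zeta>"])
    show "convex (S \<inter> ball \<zeta> d)"
      using S by (simp add: convex_Int)
    fix x assume x: "x \<in> S \<inter> ball \<zeta> d"
    show "((\<lambda>z. f z - F \<zeta> * z) has_field_derivative F x - F \<zeta>) (at x within S \<inter> ball \<zeta> d)"
      using x by (auto intro!: derivative_eq_intros DERIV_subset[OF der])
    show "cmod (F x - F \<zeta>) \<le> e"
      using d(2)[rule_format, of x] x ST by (auto simp: dist_norm norm_minus_commute)
  qed (use that in auto)
  have "norm (f y - f \<zeta> - F \<zeta> * (y - \<zeta>)) \<le> e * norm (y - \<zeta>)" if y: "y \<in> T" "dist y \<zeta> < d" for y
  proof -
    obtain u where u: "\<And>n. u n \<in> S" "u \<longlonglongrightarrow> y"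
      using y ST closure_sequential by blast
    obtain v where v: "\<And>n. v n \<in> S" "v \<longlonglongrightarrow> \<zeta>"
      using \<zeta> ST closure_sequential by blast
    have "(\<lambda>n. f (u n)) \<longlonglongrightarrow> f y" "(\<lambda>n. f (v n)) \<longlonglongrightarrow> f \<zeta>"
      using u v ST y \<zeta> by (auto intro!: continuous_on_tendsto_compose[OF f] always_eventually)
    then have "(\<lambda>n. cmod ((f (u n) - F \<zeta> * u n) - (f (v n) - F \<zeta> * v n)))
        \<longlonglongrightarrow> cmod ((f y - F \<zeta> * y) - (f \<zeta> - F \<zeta> * \<zeta>))"
      using u v by (intro tendsto_intros)
    moreover have "(\<lambda>n. e * cmod (u n - v n)) \<longlonglongrightarrow> e * cmod (y - \<zeta>)"
      using u v by (intro tendsto_intros)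
    moreover have "\<forall>\<^sub>F n in sequentially. dist (u n) \<zeta> < d \<and> dist (v n) \<zeta> < d"
      using y d order_tendstoD(2)[OF tendsto_dist[OF u(2) tendsto_const[of \<zeta>]]]
        order_tendstoD(2)[OF tendsto_dist[OF v(2) tendsto_const[of \<zeta>]]]
      by (intro eventually_conj) auto
    then have "\<forall>\<^sub>F n in sequentially.
        cmod ((f (u n) - F \<zeta> * u n) - (f (v n) - F \<zeta> * v n)) \<le> e * cmod (u n - v n)"
      by eventually_elim (use u v in \<open>auto intro!: inside simp: dist_commute\<close>)
    ultimately have "cmod ((f y - F \<zeta> * y) - (f \<zeta> - F \<zeta> * \<zeta>)) \<le> e * cmod (y - \<zeta>)"
      by (intro tendsto_le[OF sequentially_bot]) auto
    then show ?thesis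
      by (simp add: algebra_simps)
  qed
  then show "\<forall>\<^sub>F y in at \<zeta> within T. norm (f y - f \<zeta> - F \<zeta> * (y - \<zeta>)) \<le> e * norm (y - \<zeta>)"
    unfolding eventually_at using d(1) by blast
qed

text \<open>The maximum principle applied to the differences \<open>\<psi> m - \<psi> n\<close>
  carries the uniform Cauchy condition from the frontier to the whole set.\<close>

lemma uniformly_convergent_on_frontier:
  fixes \<psi> :: "nat \<Rightarrow> complex \<Rightarrow> complex"
  assumes "bounded S" "closed S"
    and cont: "\<And>n. continuous_on S (\<psi> n)" and hol: "\<And>n. \<psi> n holomorphic_on interior S"
    and conv: "uniformly_convergent_on (frontier S) \<psi>"
  shows "uniformly_convergent_on S \<psi>"
proof (rule Cauchy_uniformly_convergent, rule uniformly_Cauchy_onI)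
  fix e :: real assume "e > 0"
  then obtain M where M: "\<And>x m n. x \<in> frontier S \<Longrightarrow> m \<ge> M \<Longrightarrow> n \<ge> M \<Longrightarrow> dist (\<psi> m x) (\<psi> n x) < e/2"
    using uniformly_convergent_Cauchy[OF conv] unfolding uniformly_Cauchy_on_def
    by (meson half_gt_zero)
  have "cmod (\<psi> m x - \<psi> n x) \<le> e/2" if "x \<in> S" "m \<ge> M" "n \<ge> M" for x m n
  proof (rule maximum_modulus_frontier[of "\<lambda>x. \<psi> m x - \<psi> n x" S])
    show "continuous_on (closure S) (\<lambda>x. \<psi> m x - \<psi> n x)"
      using \<open>closed S\<close> by (simp add: cont continuous_on_diff)
    show "cmod (\<psi> m z - \<psi> n z) \<le> e/2" if "z \<in> frontier S" for z
      using M[OF that \<open>m \<ge> M\<close> \<open>n \<ge> M\<close>] by (simp add: dist_norm)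
  qed (use \<open>bounded S\<close> \<open>x \<in> S\<close> in \<open>auto intro: holomorphic_on_diff hol\<close>)
  then show "\<exists>M. \<forall>x\<in>S. \<forall>m\<ge>M. \<forall>n\<ge>M. dist (\<psi> m x) (\<psi> n x) < e"
    using \<open>e > 0\<close> by (intro exI[of _ M]) (force simp: dist_norm)
qed

section \<open>Difference quotients with real increments\<close>

text \<open>First-order Taylor expansion along the horizontal segment from \<open>w\<close> to
  \<open>w + h\<close>: \<open>Im\<close> is constant on it, so the hypothesis on the second
  derivative is one fixed bound there.\<close>

lemma difference_quotient_upper_half_plane:
  fixes \<phi> :: "complex \<Rightarrow> complex"
  assumes hol: "\<phi> holomorphic_on {w. Im w > 0}"
    and bd: "\<And>w. Im w > 0 \<Longrightarrow> a \<le> Re w \<Longrightarrow> Re w \<le> b + h \<Longrightarrow> Im w \<le> c \<Longrightarrow>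
              cmod (deriv (deriv \<phi>) w) \<le> B / (Im w)\<^sup>2"
    and w: "Im w > 0" "a \<le> Re w" "Re w \<le> b" "Im w \<le> c" and h: "h > 0"
  shows "cmod ((\<phi> (w + of_real h) - \<phi> w) / of_real h - deriv \<phi> w) \<le> B * h / (Im w)\<^sup>2"
proof -
  define f where "f i = (deriv ^^ i) \<phi>" for i
  have op: "open {w. Im w > 0}"
    by (rule open_halfspace_Im_gt)
  have "closed_segment w (w + of_real h) \<subseteq> {x. Im x = Im w \<and> Re w \<le> Re x \<and> Re x \<le> Re w + h}"
  proof
    fix x assume "x \<in> closed_segment w (w + of_real h)"
    then obtain u where u: "0 \<le> u" "u \<le> 1" "x = (1 - u) *\<^sub>R w + u *\<^sub>R (w + of_real h)"
      unfolding closed_segment_def by blast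
    have "u * h \<le> h" "0 \<le> u * h"
      using u h by (simp_all add: mult_left_le_one_le)
    then show "x \<in> {x. Im x = Im w \<and> Re w \<le> Re x \<and> Re x \<le> Re w + h}"
      using u(3) by (simp add: algebra_simps)
  qed
  then have seg: "Im x = Im w" "Re w \<le> Re x" "Re x \<le> Re w + h"
    if "x \<in> closed_segment w (w + of_real h)" for x
    using that by auto
  have "cmod (f 0 (w + of_real h) - (\<Sum>i\<le>1. f i w * (w + of_real h - w) ^ i / fact i))
      \<le> B / (Im w)\<^sup>2 * cmod (w + of_real h - w) ^ Suc 1 / fact 1"
  proof (rule complex_Taylor)
    fix i x assume x: "x \<in> closed_segment w (w + of_real h)"
    have "f i holomorphic_on {w. Im w > 0}"
      unfolding f_def by (rule holomorphic_higher_deriv[OF hol op])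
    then show "(f i has_field_derivative f (Suc i) x) (at x within closed_segment w (w + of_real h))"
      using seg[OF x] w op holomorphic_derivI[of "f i" "{w. Im w > 0}" x] by (simp add: f_def)
    show "cmod (f (Suc 1) x) \<le> B / (Im w)\<^sup>2"
      using bd[of x] seg[OF x] w h by (simp add: f_def)
  qed auto
  then have T: "cmod (\<phi> (w + of_real h) - \<phi> w - deriv \<phi> w * of_real h) \<le> B * h\<^sup>2 / (Im w)\<^sup>2"
    using h by (simp add: f_def power2_eq_square algebra_simps)
  have "(\<phi> (w + of_real h) - \<phi> w) / of_real h - deriv \<phi> w
      = (\<phi> (w + of_real h) - \<phi> w - deriv \<phi> w * of_real h) / of_real h"
    using h by (simp add: field_simps)
  then have "cmod ((\<phi> (w + of_real h) - \<phi> w) / of_real h - deriv \<phi> w)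
      = cmod (\<phi> (w + of_real h) - \<phi> w - deriv \<phi> w * of_real h) / h"
    using h by (simp add: norm_divide)
  also have "\<dots> \<le> B * h\<^sup>2 / (Im w)\<^sup>2 / h"
    using T h by (intro divide_right_mono) auto
  finally show ?thesis
    using h by (simp add: power2_eq_square)
qed

text \<open>The derivative is uniformly continuous on the compact interval, and the mean value
  inequality turns this into a bound uniform in \<open>t\<close>. The gap between \<open>b\<close>
  and \<open>c\<close> leaves room for \<open>t + h\<close>.\<close>

lemma difference_quotient_uniform:
  fixes g d :: "real \<Rightarrow> 'a::real_normed_vector"
  assumes g: "\<And>t. t \<in> {a..c} \<Longrightarrow> (g has_vector_derivative d t) (at t within {a..c})"
    and d: "continuous_on {a..c} d" and bc: "b < c" and e: "e > 0"
  shows "\<exists>h0>0. \<forall>t\<in>{a..b}. \<forall>h\<in>{0<..<h0}. norm ((g (t + h) - g t) /\<^sub>R h - d t) \<le> e"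
proof -
  have "uniformly_continuous_on {a..c} d"
    using d by (simp add: compact_uniformly_continuous)
  then obtain h1 where h1: "h1 > 0"
    "\<forall>x\<in>{a..c}. \<forall>x'\<in>{a..c}. dist x' x < h1 \<longrightarrow> dist (d x') (d x) < e"
    using e unfolding uniformly_continuous_on_def by blast
  have "norm ((g (t + h) - g t) /\<^sub>R h - d t) \<le> e"
    if t: "a \<le> t" "t \<le> b" "0 < h" "h < min h1 (c - b)" for t h
  proof -
    have "norm (g (t + h) - g t - (t + h - t) *\<^sub>R d t) \<le> norm (t + h - t) * e"
    proof (rule vector_differentiable_bound_linearization[of "{t..t+h}"])
      fix x assume x: "x \<in> {t..t + h}"
      show "(g has_vector_derivative d x) (at x within {t..t + h})"
        using x t by (intro has_vector_derivative_within_subset[OF g]) auto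
      show "norm (d x - d t) \<le> e"
        using h1(2)[rule_format, of t x] x t by (auto simp: dist_norm)
    qed (use t in \<open>auto simp: closed_segment_eq_real_ivl\<close>)
    then have "norm (g (t + h) - g t - h *\<^sub>R d t) \<le> h * e"
      using t by simp
    moreover have "(g (t + h) - g t) /\<^sub>R h - d t = (g (t + h) - g t - h *\<^sub>R d t) /\<^sub>R h"
      using t by (simp add: scaleR_right_diff_distrib)
    ultimately have "norm ((g (t + h) - g t) /\<^sub>R h - d t) \<le> inverse h * (h * e)"
      using t by (simp add: mult_left_mono)
    also have "\<dots> = e"
      using t by simp
    finally show ?thesis .
  qed
  then show ?thesis
    using h1(1) bc by (intro exI[of _ "min h1 (c - b)"]) auto
qed

section \<open>Boundary limits of the derivative on the real axis\<close>

text \<open>Only the existence of the limit is claimed; on the arc, its relation to the derivative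
  of the boundary function comes from \<open>vector_derivative_along_arc\<close>.\<close>

lemma deriv_tendsto_real_axis:
  fixes \<phi> :: "complex \<Rightarrow> complex" and d :: "real \<Rightarrow> complex"
  assumes hol: "\<phi> holomorphic_on {w. Im w > 0}"
    and cont: "continuous_on ({w. Im w > 0} \<union> of_real ` {\<alpha><..<\<beta>}) \<phi>"
    and der: "\<And>t. t \<in> {\<alpha><..<\<beta>} \<Longrightarrow> ((\<lambda>t. \<phi> (of_real t)) has_vector_derivative d t) (at t)"
    and d: "continuous_on {\<alpha><..<\<beta>} d" and t0: "t0 \<in> {\<alpha><..<\<beta>}"
  shows "\<exists>l. (deriv \<phi> \<longlongrightarrow> l) (at (of_real t0) within {w. Im w > 0})"
proof -
  define U where "U = {w. Im w > 0}"
  have U: "open U"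
    unfolding U_def by (rule open_halfspace_Im_gt)
  define \<delta> where "\<delta> = min (t0 - \<alpha>) (\<beta> - t0) / 4"
  have \<delta>: "\<delta> > 0" "\<alpha> < t0 - 2 * \<delta>" "t0 + 3 * \<delta> < \<beta>"
    using t0 by (auto simp: \<delta>_def min_def field_simps)
  define a b where "a = t0 - \<delta>" and "b = t0 + \<delta>"
  have ab: "\<alpha> < a - \<delta>" "a < t0" "t0 < b" "b + 2 * \<delta> < \<beta>" "b - a = 2 * \<delta>"
    using \<delta> by (auto simp: a_def b_def)
  \<comment> \<open>\<open>E\<close> enlarges the working rectangle \<open>R\<close> so as to
    contain its translates by increments below \<open>\<delta>\<close> and the disks used in the
    Cauchy estimate below. The choice of \<open>\<delta>\<close> keeps its lower side inside the
    interval.\<close>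
  define E where "E = cbox (Complex (a - \<delta>) 0) (Complex (b + 2 * \<delta>) (2 * \<delta>))"
  have E_iff: "w \<in> E \<longleftrightarrow> a - \<delta> \<le> Re w \<and> Re w \<le> b + 2 * \<delta> \<and> 0 \<le> Im w \<and> Im w \<le> 2 * \<delta>" for w
    by (auto simp: E_def in_cbox_complex_iff)
  have E: "E \<subseteq> U \<union> of_real ` {\<alpha><..<\<beta>}"
  proof
    fix w assume w: "w \<in> E"
    show "w \<in> U \<union> of_real ` {\<alpha><..<\<beta>}"
    proof (cases "Im w = 0")
      case True
      then have "w = of_real (Re w)"
        by (simp add: complex_eq_iff)
      then show ?thesis
        using w ab \<delta> unfolding E_iff by (metis UnCI greaterThanLessThan_iff image_eqI less_le_trans le_less_trans)
    qed (use w in \<open>auto simp: E_iff U_def\<close>)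
  qed
  have contE: "continuous_on E \<phi>"
    using cont E unfolding U_def by (rule continuous_on_subset)
  then have "compact (\<phi> ` E)"
    by (rule compact_continuous_image) (simp add: E_def)
  then obtain B where B: "\<And>w. w \<in> E \<Longrightarrow> cmod (\<phi> w) \<le> B"
    by (metis compact_imp_bounded bounded_iff imageI)
  \<comment> \<open>Cauchy's estimate on the disk of radius \<open>Im w\<close>, which touches the
    real axis. The range of \<open>Re w\<close> reaches \<open>b + \<delta>\<close> because the
    Taylor segments leave \<open>R\<close> on the right.\<close>
  have deriv2: "cmod (deriv (deriv \<phi>) w) \<le> 2 * B / (Im w)\<^sup>2"
    if w: "Im w > 0" "a \<le> Re w" "Re w \<le> b + \<delta>" "Im w \<le> \<delta>" for w
  proof -
    have sub: "cball w (Im w) \<subseteq> E"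
    proof
      fix z assume "z \<in> cball w (Im w)"
      then have "\<bar>Re (w - z)\<bar> \<le> Im w" "\<bar>Im (w - z)\<bar> \<le> Im w"
        using abs_Re_le_cmod[of "w - z"] abs_Im_le_cmod[of "w - z"] by (auto simp: dist_norm)
      then show "z \<in> E"
        using w unfolding E_iff by auto
    qed
    have "ball w (Im w) \<subseteq> U"
    proof
      fix z assume "z \<in> ball w (Im w)"
      then have "\<bar>Im (w - z)\<bar> < Im w"
        using abs_Im_le_cmod[of "w - z"] by (auto simp: dist_norm)
      then show "z \<in> U"
        by (auto simp: U_def)
    qed
    then have "\<phi> holomorphic_on ball w (Im w)"
      using hol unfolding U_def by (rule holomorphic_on_subset[rotated])
    then have "cmod ((deriv ^^ 2) \<phi> w) \<le> fact 2 * B / (Im w) ^ 2"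
      using contE sub w B by (intro Cauchy_inequality) (auto simp: subset_iff dist_norm intro: continuous_on_subset)
    then show ?thesis
      by (simp add: numeral_2_eq_2)
  qed
  \<comment> \<open>A double zero at each lower corner, to offset the factor
    \<open>1 / (Im w)\<^sup>2\<close> on the vertical sides.\<close>
  define q where "q w = (w - of_real a)\<^sup>2 * (w - of_real b)\<^sup>2" for w :: complex
  \<comment> \<open>The shift by 2 makes \<open>h n < \<delta>\<close> hold already for
    \<open>n = 0\<close>.\<close>
  define h where "h n = \<delta> / real (n + 2)" for n
  have h: "h n > 0" "h n < \<delta>" for n
    using \<delta> by (auto simp: h_def field_simps add_pos_nonneg)
  have h0: "h \<longlonglongrightarrow> 0"
    unfolding h_def using LIMSEQ_ignore_initial_segment[OF lim_const_over_n[of \<delta>], of 2] by simp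
  define \<psi> where "\<psi> n w = q w * ((\<phi> (w + of_real (h n)) - \<phi> w) / of_real (h n))" for n w
  define \<Psi> where "\<Psi> w = q w * (if Im w = 0 then d (Re w) else deriv \<phi> w)" for w
  define R where "R = cbox (Complex a 0) (Complex b \<delta>)"
  have R_iff: "w \<in> R \<longleftrightarrow> a \<le> Re w \<and> Re w \<le> b \<and> 0 \<le> Im w \<and> Im w \<le> \<delta>" for w
    by (auto simp: R_def in_cbox_complex_iff)
  have intR: "interior R = box (Complex a 0) (Complex b \<delta>)"
    unfolding R_def by (rule interior_cbox)
  have intR_iff: "w \<in> interior R \<longleftrightarrow> a < Re w \<and> Re w < b \<and> 0 < Im w \<and> Im w < \<delta>" for w
    unfolding intR by (auto simp: in_box_complex_iff)
  have frontR: "w \<in> R \<and> (Re w = a \<or> Re w = b \<or> Im w = 0 \<or> Im w = \<delta>)" if "w \<in> frontier R" for w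
    using that unfolding R_def frontier_cbox
    by (auto simp: in_box_complex_iff in_cbox_complex_iff)
  have RE: "w \<in> E" "w + of_real (h n) \<in> E" if "w \<in> R" for w n
    using that h[of n] \<delta> unfolding R_iff E_iff by auto
  have contR: "continuous_on R (\<psi> n)" for n
  proof -
    have "continuous_on R (\<lambda>w. \<phi> (w + of_real (h n)))"
      using RE by (intro continuous_on_compose2[OF contE] continuous_intros) auto
    moreover have "continuous_on R \<phi>"
      using RE contE by (auto intro: continuous_on_subset)
    ultimately show ?thesis
      unfolding \<psi>_def q_def using h[of n] by (intro continuous_intros) auto
  qed
  have holR: "\<psi> n holomorphic_on interior R" for n
  proof -
    have "(\<phi> \<circ> (\<lambda>w. w + of_real (h n))) holomorphic_on interior R"
      by (intro holomorphic_on_compose_gen[OF _ hol] holomorphic_intros) (auto simp: intR_iff)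
    moreover have "\<phi> holomorphic_on interior R"
      using hol by (rule holomorphic_on_subset) (auto simp: intR_iff)
    ultimately show ?thesis
      unfolding \<psi>_def q_def o_def using h[of n] by (intro holomorphic_intros) auto
  qed
  have le_3\<delta>: "cmod (w - of_real a) \<le> 3 * \<delta>" "cmod (w - of_real b) \<le> 3 * \<delta>" if "w \<in> R" for w
  proof -
    have "\<bar>Re w - a\<bar> \<le> 2 * \<delta>" "\<bar>Re w - b\<bar> \<le> 2 * \<delta>" "\<bar>Im w\<bar> \<le> \<delta>"
      using that ab(5) unfolding R_iff abs_le_iff by linarith+
    then show "cmod (w - of_real a) \<le> 3 * \<delta>" "cmod (w - of_real b) \<le> 3 * \<delta>"
      using cmod_le[of "w - of_real a"] cmod_le[of "w - of_real b"] by simp_all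
  qed
  have norm_q: "cmod (q w) = (cmod (w - of_real a))\<^sup>2 * (cmod (w - of_real b))\<^sup>2" for w
    by (simp add: q_def norm_mult norm_power)
  have q_le: "cmod (q w) \<le> 81 * \<delta> ^ 4" if "w \<in> R" for w
  proof -
    have "cmod (q w) \<le> (3 * \<delta>)\<^sup>2 * (3 * \<delta>)\<^sup>2"
      unfolding norm_q using le_3\<delta>[OF that] by (intro mult_mono power_mono) auto
    then show ?thesis
      by (simp add: power_mult_distrib flip: power_add)
  qed
  \<comment> \<open>On a vertical side the distance to its lower corner is exactly
    \<open>Im w\<close>; on the top side \<open>Im w = \<delta>\<close> and \<open>q_le\<close>
    suffices.\<close>
  have q_le_Im: "cmod (q w) \<le> 81 * \<delta>\<^sup>2 * (Im w)\<^sup>2" if "w \<in> frontier R" "Im w > 0" for w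
  proof -
    have wR: "w \<in> R"
      using frontR that by blast
    consider "Re w = a" | "Re w = b" | "Im w = \<delta>"
      using frontR[OF \<open>w \<in> frontier R\<close>] \<open>Im w > 0\<close> by auto
    then have "cmod (q w) \<le> (9 * \<delta>)\<^sup>2 * (Im w)\<^sup>2"
    proof cases
      case 1
      then have "cmod (w - of_real a) = Im w"
        using that by (simp add: cmod_def)
      then show ?thesis
        unfolding norm_q using le_3\<delta>[OF wR] \<delta> that(2)
        by (subst mult.commute) (intro mult_mono power_mono, auto)
    next
      case 2
      then have "cmod (w - of_real b) = Im w"
        using that by (simp add: cmod_def)
      then show ?thesis
        unfolding norm_q using le_3\<delta>[OF wR] \<delta> that(2)
        by (intro mult_mono power_mono) auto
    next
      case 3
      then show ?thesis
        using q_le[OF wR] by (simp add: power_mult_distrib mult.assoc flip: power_add)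
    qed
    then show ?thesis
      by (simp add: power_mult_distrib)
  qed
  have "uniform_limit (frontier R) \<psi> \<Psi> sequentially"
    unfolding uniform_limit_iff
  proof (intro allI impI)
    fix e :: real assume e: "e > 0"
    \<comment> \<open>Chosen so that the bound \<open>81 * \<delta> ^ 4\<close> for \<open>q\<close>
      times \<open>e'\<close> is \<open>e / 2\<close>.\<close>
    define e' where "e' = e / (2 * 81 * \<delta> ^ 4)"
    have e': "e' > 0" "81 * \<delta> ^ 4 * e' < e"
      using e \<delta> by (auto simp: e'_def)
    have "((\<lambda>t. \<phi> (of_real t)) has_vector_derivative d t) (at t within {a..b + \<delta>})"
      if "t \<in> {a..b + \<delta>}" for t
      by (rule has_vector_derivative_at_within[OF der]) (use that ab \<delta> in auto)
    moreover have "continuous_on {a..b + \<delta>} d"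
      using d by (rule continuous_on_subset) (use ab \<delta> in auto)
    moreover have "b < b + \<delta>"
      using \<delta> by simp
    ultimately have "\<exists>h1>0. \<forall>t\<in>{a..b}. \<forall>h\<in>{0<..<h1}.
        cmod ((\<phi> (of_real (t + h)) - \<phi> (of_real t)) /\<^sub>R h - d t) \<le> e'"
      by (rule difference_quotient_uniform[OF _ _ _ e'(1)])
    then obtain h1 where h1: "h1 > 0" "\<forall>t\<in>{a..b}. \<forall>h\<in>{0<..<h1}.
        cmod ((\<phi> (of_real (t + h)) - \<phi> (of_real t)) /\<^sub>R h - d t) \<le> e'"
      by blast
    \<comment> \<open>The constant is \<open>81 * \<delta>\<^sup>2\<close> from
      \<open>q_le_Im\<close> times \<open>2 * B\<close> from \<open>deriv2\<close>; the powers of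
      \<open>Im w\<close> cancel.\<close>
    have "(\<lambda>n. 162 * \<delta>\<^sup>2 * B * h n) \<longlonglongrightarrow> 162 * \<delta>\<^sup>2 * B * 0"
      by (intro tendsto_intros h0)
    then have "\<forall>\<^sub>F n in sequentially. 162 * \<delta>\<^sup>2 * B * h n < e"
      using e by (intro order_tendstoD(2)) auto
    moreover have "\<forall>\<^sub>F n in sequentially. h n < h1"
      using h0 h1(1) by (rule order_tendstoD(2))
    ultimately show "\<forall>\<^sub>F n in sequentially. \<forall>w\<in>frontier R. dist (\<psi> n w) (\<Psi> w) < e"
    proof eventually_elim
      case (elim n)
      show ?case
      proof
        fix w assume w: "w \<in> frontier R"
        then have wR: "w \<in> R"
          using frontR by blast
        show "dist (\<psi> n w) (\<Psi> w) < e"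
        proof (cases "Im w = 0")
          case True
          then have "w = of_real (Re w)"
            by (simp add: complex_eq_iff)
          then obtain t where t: "w = of_real t"
            by blast
          have "cmod ((\<phi> (of_real (t + h n)) - \<phi> (of_real t)) /\<^sub>R h n - d t) \<le> e'"
            using wR t elim h by (intro h1(2)[rule_format]) (auto simp: R_iff)
          then have "cmod (q w) * cmod ((\<phi> (of_real (t + h n)) - \<phi> (of_real t)) /\<^sub>R h n - d t)
              \<le> 81 * \<delta> ^ 4 * e'"
            using q_le[OF wR] by (intro mult_mono) auto
          also have "\<dots> < e"
            by (rule e')
          finally show ?thesis
            unfolding dist_norm \<psi>_def \<Psi>_def
            by (simp add: t norm_mult[symmetric] right_diff_distrib scaleR_conv_of_real divide_inverse mult.commute)
        next
          case False
          then have Im: "Im w > 0"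
            using wR by (auto simp: R_iff)
          have "cmod (q w) * cmod ((\<phi> (w + of_real (h n)) - \<phi> w) / of_real (h n) - deriv \<phi> w)
              \<le> (81 * \<delta>\<^sup>2 * (Im w)\<^sup>2) * (2 * B * h n / (Im w)\<^sup>2)"
          proof (intro mult_mono q_le_Im w Im)
            show "cmod ((\<phi> (w + of_real (h n)) - \<phi> w) / of_real (h n) - deriv \<phi> w)
                \<le> 2 * B * h n / (Im w)\<^sup>2"
              using wR Im h[of n]
              by (intro difference_quotient_upper_half_plane[OF hol deriv2, of a b _ \<delta>]) (auto simp: R_iff)
          qed auto
          also have "\<dots> = 162 * \<delta>\<^sup>2 * B * h n"
            using Im by simp
          also have "\<dots> < e"
            by (rule elim)
          finally show ?thesis
            using False unfolding dist_norm \<psi>_def \<Psi>_def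
            by (simp add: norm_mult[symmetric] right_diff_distrib)
        qed
      qed
    qed
  qed
  then have "uniformly_convergent_on (frontier R) \<psi>"
    by (rule uniformly_convergentI)
  then have "uniformly_convergent_on R \<psi>"
    by (rule uniformly_convergent_on_frontier[OF _ _ contR holR, rotated 2]) (simp_all add: R_def closed_cbox)
  then obtain L where L: "uniform_limit R \<psi> L sequentially"
    by (auto simp: uniformly_convergent_on_def)
  have contL: "continuous_on R L"
    using contR L by (intro uniform_limit_theorem[where F = sequentially]) auto
  \<comment> \<open>Pointwise, \<open>\<psi> n w\<close> tends to
    \<open>q w * deriv \<phi> w\<close>, and \<open>q\<close> vanishes only at the two corners, so
    the weight can be divided out again.\<close>
  have L_int: "deriv \<phi> w = L w / q w" if w: "w \<in> interior R" for w
  proof -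
    have "(\<phi> has_field_derivative deriv \<phi> w) (at w)"
      using w U hol by (intro holomorphic_derivI[of _ U]) (auto simp: intR_iff U_def)
    then have "((\<lambda>h. (\<phi> (w + h) - \<phi> w) / h) \<longlongrightarrow> deriv \<phi> w) (at 0)"
      by (simp add: DERIV_def)
    moreover have "filterlim (\<lambda>n. complex_of_real (h n)) (at 0) sequentially"
      using h h0 tendsto_of_real[OF h0, where ?'a = complex] 
      by (auto simp: filterlim_at less_imp_neq[symmetric] intro!: always_eventually)
    ultimately have "(\<lambda>n. (\<phi> (w + of_real (h n)) - \<phi> w) / of_real (h n)) \<longlonglongrightarrow> deriv \<phi> w"
      by (rule filterlim_compose)
    then have "(\<lambda>n. \<psi> n w) \<longlonglongrightarrow> q w * deriv \<phi> w"
      unfolding \<psi>_def by (intro tendsto_intros)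
    moreover have "(\<lambda>n. \<psi> n w) \<longlonglongrightarrow> L w"
      using L by (rule tendsto_uniform_limitI) (use w interior_subset in blast)
    ultimately have "L w = q w * deriv \<phi> w"
      using LIMSEQ_unique by blast
    moreover have "q w \<noteq> 0"
      using w by (auto simp: q_def intR_iff)
    ultimately show ?thesis
      by simp
  qed
  have t0R: "of_real t0 \<in> R"
    using ab \<delta> by (auto simp: R_iff)
  have "(L \<longlongrightarrow> L (of_real t0)) (at (of_real t0) within R)"
    using contL t0R by (simp add: continuous_on_def)
  then have "(L \<longlongrightarrow> L (of_real t0)) (at (of_real t0) within interior R)"
    by (rule tendsto_within_subset) (rule interior_subset)
  moreover have "(q \<longlongrightarrow> q (of_real t0)) (at (of_real t0) within interior R)"
    unfolding q_def by (intro tendsto_intros)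
  moreover have "q (of_real t0) \<noteq> 0"
    using ab by (simp add: q_def)
  ultimately have "((\<lambda>w. L w / q w) \<longlongrightarrow> L (of_real t0) / q (of_real t0))
      (at (of_real t0) within interior R)"
    by (rule tendsto_divide)
  then have "(deriv \<phi> \<longlongrightarrow> L (of_real t0) / q (of_real t0)) (at (of_real t0) within interior R)"
    by (rule Lim_transform_eventually) (auto simp: eventually_at_filter L_int)
  \<comment> \<open>Near \<open>t0\<close> the half plane and the interior of \<open>R\<close>
    coincide.\<close>
  moreover have "at (of_real t0) within U = at (of_real t0) within interior R"
  proof (rule at_within_nhd[of _ "ball (of_real t0) \<delta>"])
    have "Re w \<in> {a<..<b} \<and> Im w < \<delta>" if "w \<in> ball (of_real t0) \<delta>" for w
      using that abs_Re_le_cmod[of "of_real t0 - w"] abs_Im_le_cmod[of "of_real t0 - w"]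
      by (auto simp: dist_norm a_def b_def)
    then show "U \<inter> ball (of_real t0) \<delta> - {of_real t0} = interior R \<inter> ball (of_real t0) \<delta> - {of_real t0}"
      unfolding U_def by (fastforce simp: intR_iff)
  qed (use \<delta> in auto)
  ultimately show ?thesis
    unfolding U_def by auto
qed

section \<open>Continuous extension to the arc\<close>

text \<open>Metric spaces are regular, so limits at the points of \<open>T\<close>, taken within the
  dense subset \<open>S\<close>, assemble into a continuous map. At points of \<open>S\<close> the
  limits come from continuity of \<open>h\<close>.\<close>

lemma continuous_extension_pointwise:
  fixes h :: "'a::metric_space \<Rightarrow> 'b::metric_space"
  assumes "S \<subseteq> T" "T \<subseteq> closure S" "continuous_on S h"
    and lim: "\<And>x. x \<in> T - S \<Longrightarrow> \<exists>l. (h \<longlongrightarrow> l) (at x within S)"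
  shows "\<exists>F. continuous_extension h S T F"
proof -
  have atin: "atin_within euclidean x S = at x within S" for x :: 'a
    by (rule filter_eqI) (simp add: eventually_atin_within eventually_at_topological, blast)
  obtain F where "continuous_map (top_of_set T) euclidean F" "\<And>x. x \<in> S \<Longrightarrow> F x = h x"
    by (rule continuous_map_extension_pointwise_alt[of euclidean S T euclidean h])
       (use assms atin in \<open>auto simp: regular_space_euclidean\<close>)
  then show ?thesis
    by (auto simp: continuous_extension_def)
qed

lemma ball_open_arc_closure:
  "ball 0 1 \<subseteq> ball 0 1 \<union> open_arc" "ball 0 1 \<union> open_arc \<subseteq> closure (ball 0 1)"
  by (auto simp: open_arc_def)

text \<open>The chain rule only needs the derivative of \<open>f\<close> relative to the arc, a
  restriction of the one that \<open>has_field_derivative_boundary\<close> provides relative to the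
  disk with its arc.\<close>

lemma vector_derivative_along_arc:
  assumes cont: "continuous_on (ball 0 1 \<union> open_arc) f"
    and hol: "f holomorphic_on ball 0 1"
    and g: "\<And>t. t \<in> {0<..<1} \<Longrightarrow> g t = f (exp (\<i> * of_real t))"
    and F: "continuous_extension (deriv f) (ball 0 1) (ball 0 1 \<union> open_arc) F"
    and t: "t \<in> {0<..<1}"
  shows "(g has_vector_derivative \<i> * exp (\<i> * of_real t) * F (exp (\<i> * of_real t))) (at t)"
proof -
  let ?e = "\<lambda>t::real. exp (\<i> * of_real t)" and ?I = "{0<..<1::real}"
  have arc: "?e ` ?I \<subseteq> ball 0 1 \<union> open_arc"
    by (auto simp: open_arc_def)
  have "(f has_field_derivative F (?e t)) (at (?e t) within ball 0 1 \<union> open_arc)"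
  proof (rule has_field_derivative_boundary[OF convex_ball ball_open_arc_closure cont])
    fix z :: complex assume z: "z \<in> ball 0 1"
    then have "F z = deriv f z"
      using F by (auto simp: continuous_extension_def)
    then show "(f has_field_derivative F z) (at z within ball 0 1)"
      using holomorphic_derivI[OF hol _ z] by simp
  qed (use F t in \<open>auto simp: continuous_extension_def open_arc_def\<close>)
  then have "(f has_field_derivative F (?e t)) (at (?e t) within ?e ` ?I)"
    using arc by (rule DERIV_subset)
  moreover have "(?e has_vector_derivative \<i> * ?e t) (at t within ?I)"
    by (auto intro!: derivative_eq_intros has_vector_derivative_real_field simp: mult.commute)
  ultimately have "(f \<circ> ?e has_vector_derivative (\<i> * ?e t) * F (?e t)) (at t within ?I)"
    by (intro field_vector_diff_chain_within)
  then have "(f \<circ> ?e has_vector_derivative (\<i> * ?e t) * F (?e t)) (at t)"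
    by (simp add: at_within_open[OF t])
  then show ?thesis
    by (rule has_vector_derivative_transform_within_open[of _ _ _ ?I]) (use t g in auto)
qed

text \<open>The substitution \<open>z = exp (\<i> * w)\<close> reduces the claim to
  \<open>deriv_tendsto_real_axis\<close>. The limit returns to the disk through
  \<open>w = - \<i> * Ln z\<close>, and the principal branch is continuous at the arc.\<close>

lemma deriv_extends_to_arc:
  assumes cont: "continuous_on (ball 0 1 \<union> open_arc) f"
    and hol: "f holomorphic_on ball 0 1"
    and g: "\<And>t. t \<in> {0<..<1} \<Longrightarrow> g t = f (exp (\<i> * of_real t))"
    and der: "\<And>t. t \<in> {0<..<1} \<Longrightarrow> (g has_vector_derivative d t) (at t)"
    and d: "continuous_on {0<..<1} d"
  shows "\<exists>F. continuous_extension (deriv f) (ball 0 1) (ball 0 1 \<union> open_arc) F"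
proof (rule continuous_extension_pointwise[OF ball_open_arc_closure])
  show "continuous_on (ball 0 1) (deriv f)"
    by (intro holomorphic_on_imp_continuous_on holomorphic_deriv hol open_ball)
  fix \<zeta> assume "\<zeta> \<in> ball 0 1 \<union> open_arc - ball 0 1"
  then obtain t where \<zeta>: "\<zeta> = exp (\<i> * of_real t)" and t: "t \<in> {0<..<1}"
    by (auto simp: open_arc_def)
  define U where "U = {w. Im w > 0}"
  have U: "open U"
    unfolding U_def by (rule open_halfspace_Im_gt)
  define \<phi> where "\<phi> w = f (exp (\<i> * w))" for w
  have exp_U: "exp (\<i> * w) \<in> ball 0 1" if "w \<in> U" for w
    using that by (simp add: U_def)
  have "(f \<circ> (\<lambda>w. exp (\<i> * w))) holomorphic_on U"
    by (intro holomorphic_on_compose_gen[OF _ hol] holomorphic_intros) (use exp_U in auto)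
  then have hol\<phi>: "\<phi> holomorphic_on U"
    by (simp add: \<phi>_def[abs_def] o_def)
  have cont\<phi>: "continuous_on (U \<union> of_real ` {0<..<1}) \<phi>"
    unfolding \<phi>_def
    by (intro continuous_on_compose2[OF cont] continuous_intros) (use exp_U in \<open>auto simp: open_arc_def\<close>)
  have der\<phi>: "((\<lambda>t. \<phi> (of_real t)) has_vector_derivative d t) (at t)" if "t \<in> {0<..<1}" for t
    by (rule has_vector_derivative_transform_within_open[OF der[OF that], of "{0<..<1}"])
       (use that g in \<open>auto simp: \<phi>_def\<close>)
  obtain l where l: "(deriv \<phi> \<longlongrightarrow> l) (at (of_real t) within U)"
    using deriv_tendsto_real_axis[OF hol\<phi>[unfolded U_def] cont\<phi>[unfolded U_def] der\<phi> d t]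
    unfolding U_def by blast
  have deriv\<phi>: "deriv \<phi> w = \<i> * exp (\<i> * w) * deriv f (exp (\<i> * w))" if "w \<in> U" for w
  proof -
    have "(f has_field_derivative deriv f (exp (\<i> * w))) (at (exp (\<i> * w)))"
      using exp_U[OF that] hol by (intro holomorphic_derivI[of _ "ball 0 1"]) auto
    then have "(\<phi> has_field_derivative deriv f (exp (\<i> * w)) * (exp (\<i> * w) * \<i>)) (at w)"
      unfolding \<phi>_def by (rule DERIV_chain2) (auto intro!: derivative_eq_intros)
    then show ?thesis
      by (simp add: DERIV_imp_deriv mult_ac)
  qed
  \<comment> \<open>As \<open>0 < t < 1 < pi / 2\<close>, the point lies in the right half plane,
    off the branch cut of \<open>Ln\<close>.\<close>
  have \<zeta>_Re: "\<zeta> \<notin> \<real>\<^sub>\<le>\<^sub>0"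
  proof -
    have "cos t > 0"
      using t pi_gt3 by (intro cos_gt_zero_pi) auto
    then show ?thesis
      by (auto simp: \<zeta> complex_nonpos_Reals_iff Re_exp)
  qed
  have Ln\<zeta>: "- \<i> * Ln \<zeta> = of_real t"
    using t pi_gt3 by (simp add: \<zeta> Ln_exp)
  \<comment> \<open>The imaginary part of \<open>- \<i> * Ln z\<close> is
    \<open>- ln (cmod z)\<close>; the origin must be excluded.\<close>
  have Ln_U: "- \<i> * Ln z \<in> U" if "z \<in> ball 0 1 - {0}" for z
    using that by (simp add: U_def)
  have "((\<lambda>z. - \<i> * Ln z) \<longlongrightarrow> - \<i> * Ln \<zeta>) (at \<zeta> within ball 0 1)"
    by (intro tendsto_intros) (use \<zeta>_Re in \<open>auto simp: \<zeta>\<close>)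
  moreover have near: "\<forall>\<^sub>F z in at \<zeta> within ball 0 1. z \<in> ball 0 1 - {0}"
    using tendsto_imp_eventually_ne[OF tendsto_ident_at, of \<zeta> 0 "ball 0 1"]
    unfolding eventually_at_filter by (auto simp: \<zeta> elim: eventually_mono)
  ultimately have "filterlim (\<lambda>z. - \<i> * Ln z) (at (of_real t) within U) (at \<zeta> within ball 0 1)"
    unfolding filterlim_at Ln\<zeta>
  proof (intro conjI)
    show "\<forall>\<^sub>F z in at \<zeta> within ball 0 1. - \<i> * Ln z \<in> U \<and> - \<i> * Ln z \<noteq> of_real t"
      using near
    proof eventually_elim
      case (elim z)
      have "of_real t \<notin> U"
        by (simp add: U_def)
      then show ?case
        using Ln_U[OF elim] by metis
    qed
  qed
  \<comment> \<open>Dividing by \<open>\<i> * z\<close> undoes the chain rule factor in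
    \<open>deriv\<phi>\<close>.\<close>
  from filterlim_compose[OF l this]
  have "((\<lambda>z. deriv \<phi> (- \<i> * Ln z) / (\<i> * z)) \<longlongrightarrow> l / (\<i> * \<zeta>)) (at \<zeta> within ball 0 1)"
    by (intro tendsto_intros) (auto simp: \<zeta>)
  moreover have "\<forall>\<^sub>F z in at \<zeta> within ball 0 1. deriv \<phi> (- \<i> * Ln z) / (\<i> * z) = deriv f z"
    using near
  proof eventually_elim
    case (elim z)
    have "exp (\<i> * (- \<i> * Ln z)) = z"
      using elim by (simp flip: mult.assoc)
    then show ?case
      using deriv\<phi>[OF Ln_U[OF elim]] elim by simp
  qed
  ultimately show "\<exists>l. (deriv f \<longlongrightarrow> l) (at \<zeta> within ball 0 1)"
    using Lim_transform_eventually by blast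
qed

section \<open>Higher derivatives and the classes \<open>Cp_on\<close>\<close>

text \<open>Leibniz's rule for the product of \<open>\<i> * z\<close> and \<open>deriv f\<close>:
  the first factor is linear, so only two terms survive.\<close>

lemma higher_deriv_rotation:
  assumes S: "open S" and hol: "f holomorphic_on S"
    and G: "\<And>z. z \<in> S \<Longrightarrow> G z = \<i> * z * deriv f z" and z: "z \<in> S"
  shows "(deriv ^^ l) G z = \<i> * z * (deriv ^^ Suc l) f z + \<i> * of_nat l * (deriv ^^ l) f z"
  using z
proof (induction l arbitrary: z)
  case 0
  then show ?case
    using G by simp
next
  case (Suc l)
  have der: "((deriv ^^ k) f has_field_derivative (deriv ^^ Suc k) f z) (at z)" for k
    using holomorphic_derivI[OF holomorphic_higher_deriv[OF hol S] S Suc.prems] by simp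
  have "((\<lambda>z. \<i> * z * (deriv ^^ Suc l) f z + \<i> * of_nat l * (deriv ^^ l) f z) has_field_derivative
      \<i> * z * (deriv ^^ Suc (Suc l)) f z + \<i> * of_nat (Suc l) * (deriv ^^ Suc l) f z) (at z)"
    by (rule derivative_eq_intros der refl)+ (simp add: algebra_simps)
  then have "((deriv ^^ l) G has_field_derivative
      \<i> * z * (deriv ^^ Suc (Suc l)) f z + \<i> * of_nat (Suc l) * (deriv ^^ Suc l) f z) (at z)"
    by (rule has_field_derivative_transform_within_open[OF _ S Suc.prems]) (simp only: Suc.IH)
  then show ?case
    by (simp add: DERIV_imp_deriv)
qed

lemma Cp_on_0: "Cp_on (enat 0) S g \<longleftrightarrow> continuous_on S g"
  by (simp add: Cp_on_def iterated_vector_derivative_def enat_0 enat_0_iff)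

text \<open>Peels off the innermost derivative, as the induction passes from \<open>g\<close> to its
  derivative. Continuity of \<open>g\<close> itself follows from differentiability.\<close>

lemma Cp_on_Suc:
  "Cp_on (enat (Suc n)) S g \<longleftrightarrow>
     (\<forall>t\<in>S. g differentiable (at t)) \<and> Cp_on (enat n) S (\<lambda>t. vector_derivative g (at t))"
proof -
  have it0: "iterated_vector_derivative 0 g = g"
    and itS: "iterated_vector_derivative (Suc l) g = iterated_vector_derivative l (\<lambda>t. vector_derivative g (at t))"
    for l
    unfolding iterated_vector_derivative_def funpow_Suc_right by simp_all
  have "continuous_on S g" if "\<forall>t\<in>S. g differentiable (at t)"
    using that by (intro differentiable_imp_continuous_on)
      (simp add: differentiable_on_def differentiable_at_withinI)
  then show ?thesis
    unfolding Cp_on_def enat_ord_simps All_less_Suc2 less_Suc_eq_le[symmetric] it0 itS by auto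
qed

text \<open>Reduces infinite \<open>p\<close> to finite orders; differentiability at a level
  \<open>l < p\<close> is read off from order \<open>Suc l\<close>.\<close>

lemma Cp_on_iff_nat: "Cp_on p S g \<longleftrightarrow> (\<forall>n. enat n \<le> p \<longrightarrow> Cp_on (enat n) S g)"
proof
  assume "Cp_on p S g"
  then show "\<forall>n. enat n \<le> p \<longrightarrow> Cp_on (enat n) S g"
    unfolding Cp_on_def by (meson less_le_trans order_trans)
next
  assume *: "\<forall>n. enat n \<le> p \<longrightarrow> Cp_on (enat n) S g"
  show "Cp_on p S g"
    unfolding Cp_on_def
  proof (intro conjI allI impI)
    fix l assume "enat l < p"
    then have "Cp_on (enat (Suc l)) S g"
      using * by (simp add: Suc_ile_eq)
    then show "\<forall>t\<in>S. iterated_vector_derivative l g differentiable (at t)"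
      unfolding Cp_on_def by simp
  qed (use * in \<open>auto simp: Cp_on_def\<close>)
qed

section \<open>Induction on the order of smoothness\<close>

text \<open>If \<open>F\<close> extends \<open>deriv f\<close>, then
  \<open>G z = \<i> * z * F z\<close> has the derivative of \<open>g\<close> as its boundary
  function, so the induction hypothesis applies to this new pair. Leibniz's rule translates between
  derivatives of \<open>G\<close> and of \<open>f\<close>.\<close>

lemma extends_iff_Cp_on:
  assumes "continuous_on (ball 0 1 \<union> open_arc) f" "f holomorphic_on ball 0 1"
    and "\<And>t. t \<in> {0<..<1} \<Longrightarrow> g t = f (exp (\<i> * of_real t))"
  shows "(\<forall>l\<le>n. \<exists>F. continuous_extension ((deriv ^^ l) f) (ball 0 1) (ball 0 1 \<union> open_arc) F)
     \<longleftrightarrow> Cp_on (enat n) {0<..<1} g"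
  using assms
proof (induction n arbitrary: f g)
  case (0 f g)
  have "continuous_on {0<..<1} (\<lambda>t::real. f (exp (\<i> * of_real t)))"
    by (intro continuous_on_compose2[OF 0(1)] continuous_intros) (auto simp: open_arc_def)
  then have "continuous_on {0<..<1} g"
    by (rule continuous_on_eq) (simp add: 0(3))
  then show ?case
    using 0(1) by (auto simp: Cp_on_0 continuous_extension_def)
next
  case (Suc n f g)
  let ?D = "ball 0 1 :: complex set" and ?T = "ball 0 1 \<union> open_arc"
  let ?ext = "\<lambda>h. \<exists>F. continuous_extension h ?D ?T F"
  let ?L = "\<forall>l\<le>Suc n. ?ext ((deriv ^^ l) f)" and ?R = "Cp_on (enat (Suc n)) {0<..<1} g"
  \<comment> \<open>It is enough to argue under this assumption, since each side implies that
    \<open>deriv f\<close> extends; both implications are shown at the end.\<close>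
  have "?L \<longleftrightarrow> ?R" if F: "continuous_extension (deriv f) ?D ?T F" for F
  proof -
    define G where "G z = \<i> * z * F z" for z
    have F': "continuous_on ?T F" "\<And>z. z \<in> ?D \<Longrightarrow> F z = deriv f z"
      using F by (auto simp: continuous_extension_def)
    have G_D: "G z = \<i> * z * deriv f z" if "z \<in> ?D" for z
      using F'(2)[OF that] by (simp add: G_def)
    have contG: "continuous_on ?T G"
      unfolding G_def by (intro continuous_intros F')
    have "(\<lambda>z. \<i> * z * deriv f z) holomorphic_on ?D"
      by (intro holomorphic_intros holomorphic_deriv Suc.prems open_ball)
    then have holG: "G holomorphic_on ?D"
      by (rule holomorphic_transform) (simp add: G_D)
    note dG = higher_deriv_rotation[OF open_ball Suc.prems(2) G_D]
    have ext0: "?ext f"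
      using Suc.prems by (auto simp: continuous_extension_def)
    have vd: "(g has_vector_derivative G (exp (\<i> * of_real t))) (at t)" if "t \<in> {0<..<1}" for t
      unfolding G_def using vector_derivative_along_arc[OF Suc.prems F that] .
    have up: "?ext ((deriv ^^ l) G)" if AB: "?ext ((deriv ^^ l) f)" "?ext ((deriv ^^ Suc l) f)" for l
    proof -
      obtain A B where "continuous_extension ((deriv ^^ l) f) ?D ?T A"
        "continuous_extension ((deriv ^^ Suc l) f) ?D ?T B"
        using AB by blast
      moreover from this have "\<i> * z * B z + \<i> * of_nat l * A z = (deriv ^^ l) G z" if "z \<in> ?D" for z
        using dG[OF _ that] that by (simp add: continuous_extension_def)
      ultimately have "continuous_extension ((deriv ^^ l) G) ?D ?T (\<lambda>z. \<i> * z * B z + \<i> * of_nat l * A z)"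
        unfolding continuous_extension_def by (intro conjI continuous_intros) auto
      then show ?thesis
        by blast
    qed
    \<comment> \<open>Solves the Leibniz formula for the highest derivative of \<open>f\<close>. The
      division by \<open>\<i> * z\<close> fails at the origin, so it is used only for limits at arc
      points.\<close>
    have down: "?ext ((deriv ^^ Suc l) f)" if AB: "?ext ((deriv ^^ l) f)" "?ext ((deriv ^^ l) G)" for l
    proof (rule continuous_extension_pointwise[OF ball_open_arc_closure])
      show "continuous_on ?D ((deriv ^^ Suc l) f)"
        by (intro holomorphic_on_imp_continuous_on holomorphic_higher_deriv Suc.prems open_ball)
      fix \<zeta> assume \<zeta>: "\<zeta> \<in> ?T - ?D"
      then have "\<zeta> \<noteq> 0"
        by auto
      obtain A B where A: "continuous_extension ((deriv ^^ l) f) ?D ?T A"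
        and B: "continuous_extension ((deriv ^^ l) G) ?D ?T B"
        using AB by blast
      have "(A \<longlongrightarrow> A \<zeta>) (at \<zeta> within ?D)" "(B \<longlongrightarrow> B \<zeta>) (at \<zeta> within ?D)"
        using A B \<zeta> unfolding continuous_extension_def continuous_on_def
        by (meson DiffD1 Un_upper1 tendsto_within_subset)+
      then have "((\<lambda>z. (B z - \<i> * of_nat l * A z) / (\<i> * z))
          \<longlongrightarrow> (B \<zeta> - \<i> * of_nat l * A \<zeta>) / (\<i> * \<zeta>)) (at \<zeta> within ?D)"
        using \<open>\<zeta> \<noteq> 0\<close> by (intro tendsto_intros) auto
      moreover have "\<forall>\<^sub>F z in at \<zeta> within ?D.
          (B z - \<i> * of_nat l * A z) / (\<i> * z) = (deriv ^^ Suc l) f z"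
      proof -
        have "\<forall>\<^sub>F z in at \<zeta> within ?D. z \<noteq> 0"
          using \<open>\<zeta> \<noteq> 0\<close> by (intro tendsto_imp_eventually_ne[OF tendsto_ident_at])
        moreover have "\<forall>\<^sub>F z in at \<zeta> within ?D. z \<in> ?D"
          by (simp add: eventually_at_filter)
        ultimately show ?thesis
        proof eventually_elim
          case (elim z)
          then have "A z = (deriv ^^ l) f z" "B z = (deriv ^^ l) G z"
            using A B by (auto simp: continuous_extension_def)
          then show ?case
            using dG[of z l] elim by simp
        qed
      qed
      ultimately show "\<exists>l'. ((deriv ^^ Suc l) f \<longlongrightarrow> l') (at \<zeta> within ?D)"
        using Lim_transform_eventually by blast
    qed
    have "\<forall>t\<in>{0<..<1}. g differentiable (at t)"
      using vd differentiableI_vector by blast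
    then have "?R \<longleftrightarrow> Cp_on (enat n) {0<..<1} (\<lambda>t. vector_derivative g (at t))"
      by (simp add: Cp_on_Suc)
    also have "\<dots> \<longleftrightarrow> (\<forall>l\<le>n. ?ext ((deriv ^^ l) G))"
      using vd vector_derivative_at by (intro Suc.IH[symmetric] contG holG) blast
    also have "\<dots> \<longleftrightarrow> ?L"
    proof
      assume L: ?L
      show "\<forall>l\<le>n. ?ext ((deriv ^^ l) G)"
        using L Suc_le_mono le_SucI by (intro allI impI up) blast+
    next
      assume ext: "\<forall>l\<le>n. ?ext ((deriv ^^ l) G)"
      have "?ext ((deriv ^^ l) f)" if "l \<le> Suc n" for l
        using that
      proof (induction l)
        case 0
        then show ?case
          using ext0 by simp
      next
        case (Suc l)
        then show ?case
          using ext by (intro down) auto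
      qed
      then show ?L
        by blast
    qed
    finally show ?thesis ..
  qed
  moreover have "?ext (deriv f)" if ?L
    using that[rule_format, of 1] by simp
  moreover have "?ext (deriv f)" if ?R
  proof -
    have "\<forall>t\<in>{0<..<1}. g differentiable (at t)" "Cp_on (enat n) {0<..<1} (\<lambda>t. vector_derivative g (at t))"
      using that by (auto simp: Cp_on_Suc)
    \<comment> \<open>Order 0 in \<open>Cp_on_iff_nat\<close> supplies the continuity of the
      derivative of \<open>g\<close>.\<close>
    then show ?thesis
      using Cp_on_iff_nat[of "enat n" "{0<..<1}" "\<lambda>t. vector_derivative g (at t)"]
      by (intro deriv_extends_to_arc[OF Suc.prems, where d = "\<lambda>t. vector_derivative g (at t)"])
         (auto simp: vector_derivative_works[symmetric] Cp_on_0[symmetric])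
  qed
  ultimately show ?case
    by blast
qed

section \<open>Finite and infinite orders together, and the boundary derivative formula\<close>

theorem theorem3p7:
  fixes p :: enat and f :: "complex \<Rightarrow> complex" and g :: "real \<Rightarrow> complex"
  assumes "1 \<le> p"
    and "continuous_on (ball 0 1 \<union> open_arc) f"
    and "f holomorphic_on ball 0 1"
    and "\<And>t. t \<in> {0<..<1} \<Longrightarrow> g t = f (exp (\<i> * of_real t))"
  shows "((\<forall>l. enat l \<le> p \<longrightarrow>
             (\<exists>F. continuous_extension ((deriv ^^ l) f) (ball 0 1) (ball 0 1 \<union> open_arc) F))
          \<longleftrightarrow> Cp_on p {0<..<1} g)
       \<and> (Cp_on p {0<..<1} g \<longrightarrow>
            (\<forall>F. continuous_extension (deriv f) (ball 0 1) (ball 0 1 \<union> open_arc) F \<longrightarrow>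
              (\<forall>t\<in>{0<..<1}.
                 (g has_vector_derivative \<i> * exp (\<i> * of_real t) * F (exp (\<i> * of_real t))) (at t))))"
proof (intro conjI impI allI ballI)
  let ?ext = "\<lambda>l. \<exists>F. continuous_extension ((deriv ^^ l) f) (ball 0 1) (ball 0 1 \<union> open_arc) F"
  \<comment> \<open>Regroups the orders up to \<open>p\<close> into finite initial blocks, the form
    matching \<open>Cp_on_iff_nat\<close>.\<close>
  have "(\<forall>l. enat l \<le> p \<longrightarrow> ?ext l) \<longleftrightarrow> (\<forall>n. enat n \<le> p \<longrightarrow> (\<forall>l\<le>n. ?ext l))"
  proof (intro iffI allI impI)
    fix n l
    assume "\<forall>l. enat l \<le> p \<longrightarrow> ?ext l" "enat n \<le> p" "l \<le> n"
    then show "?ext l"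
      using order_trans[of "enat l" "enat n" p] by simp
  qed blast
  also have "\<dots> \<longleftrightarrow> Cp_on p {0<..<1} g"
    using extends_iff_Cp_on[OF assms(2-4)] Cp_on_iff_nat[of p "{0<..<1}" g] by simp
  finally show "(\<forall>l. enat l \<le> p \<longrightarrow> ?ext l) \<longleftrightarrow> Cp_on p {0<..<1} g" .
next
  fix F and t :: real
  assume "continuous_extension (deriv f) (ball 0 1) (ball 0 1 \<union> open_arc) F" "t \<in> {0<..<1}"
  then show "(g has_vector_derivative \<i> * exp (\<i> * of_real t) * F (exp (\<i> * of_real t))) (at t)"
    using vector_derivative_along_arc[OF assms(2-4)] by blast
qed

end
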